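(* For any set $X$, the partition monoid $\mathcal{P}_X$ is (two-sided) $F$-Ehresmann with respect to the semilattice $F=E(\mathcal{J}_X)=\{\mathrm{id}_\varepsilon:\varepsilon\text{ an equivalence relation on }X\}$, where $\mathcal{J}_X$ is the dual symmetric inverse monoid.
   Context: Partition monoid: let $X$ be a set and $X'=\{x':x\in X\}$ a disjoint copy of $X$. $\mathcal{P}_X$ is the set of all set partitions of $X\cup X'$. Given $\alpha,\beta\in\mathcal{P}_X$, let $X''=\{x'':x\in X\}$ be another disjoint copy; represent $\alpha$ and $\beta$ by graphs on $X\cup X'$ whose connected components are the blocks; rename each lower vertex $x'$ of $\alpha$ to $x''$ and each upper vertex $x$ of $\beta$ to $x''$; take the union of these graphs on $X\cup X''\cup X'$. The product $\alpha\beta$ is the partition of $X\cup X'$ in which two elements lie in the same block iff they are joined by a path in this union graph. This makes $\mathcal{P}_X$ a monoid. A block is a transversal if it meets both $X$ and $X'$. $\mathrm{dom}(\alpha)$ (resp. $\mathrm{codom}(\alpha)$) is the set of $x\in X$ such that $x$ (resp. $x'$) belongs to a transversal of $\alpha$. The dual symmetric inverse monoid is the submonoid $\mathcal{J}_X=\{\alpha\in\mathcal{P}_X:\mathrm{dom}(\alpha)=\mathrm{codom}(\alpha)=X\}$. For an equivalence $\varepsilon$ on $X$, $\mathrm{id}_\varepsilon=\{A\cup A':A\in X/\varepsilon\}\in\mathcal{P}_X$. The set of idempotents of $\mathcal{J}_X$ is $E(\mathcal{J}_X)=\{\mathrm{id}_\varepsilon\}$, with $\mathrm{id}_\varepsilon\mathrm{id}_\eta=\mathrm{id}_{\varepsilon\vee\eta}$.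 Ehresmann semigroups: let $S$ be a semigroup and $E\subseteq S$ a semilattice (a commutative subsemigroup consisting of idempotents). For $x\in S$ let $E_L(x)=\{e\in E:x=ex\}$ and $E_R(x)=\{e\in E:x=xe\}$. Define $x\,\mathscr{R}^E\,y\iff E_L(x)=E_L(y)$ and $x\,\mathscr{L}^E\,y\iff E_R(x)=E_R(y)$. $S$ is left $E$-Ehresmann if (L1) every $\mathscr{R}^E$-class contains precisely one element of $E$, and (L2) $\mathscr{R}^E$ is a left congruence ($x\,\mathscr{R}^E\,y\Rightarrow ax\,\mathscr{R}^E\,ay$ for all $a,x,y\in S$). $S$ is right $E$-Ehresmann if (R1) every $\mathscr{L}^E$-class contains precisely one element of $E$, and (R2) $\mathscr{L}^E$ is a right congruence ($x\,\mathscr{L}^E\,y\Rightarrow xa\,\mathscr{L}^E\,ya$). $S$ is (two-sided) $E$-Ehresmann if it is both left and right $E$-Ehresmann. *)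

theory Defs
  imports "HOL-Algebra.Group" "HOL-Library.Disjoint_Sets"
begin

section \<open>Ehresmann semigroups\<close>

text \<open>Semigroups reuse the record type of HOL-Algebra monoids; the unit field is ignored.\<close>

locale carrier_semigroup =
  fixes S (structure)
  assumes mult_closed: "\<lbrakk>x \<in> carrier S; y \<in> carrier S\<rbrakk> \<Longrightarrow> x \<otimes> y \<in> carrier S"
    and mult_assoc: "\<lbrakk>x \<in> carrier S; y \<in> carrier S; z \<in> carrier S\<rbrakk>
      \<Longrightarrow> (x \<otimes> y) \<otimes> z = x \<otimes> (y \<otimes> z)"

definition idempotents :: "('a, 'b) monoid_scheme \<Rightarrow> 'a set" where
  "idempotents S = {e \<in> carrier S. e \<otimes>\<^bsub>S\<^esub> e = e}"

locale semigroup_with_semilattice = carrier_semigroup S for S (structure) +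
  fixes E
  assumes idem: "E \<subseteq> idempotents S"
    and E_closed: "\<lbrakk>e \<in> E; f \<in> E\<rbrakk> \<Longrightarrow> e \<otimes> f \<in> E"
    and E_comm: "\<lbrakk>e \<in> E; f \<in> E\<rbrakk> \<Longrightarrow> e \<otimes> f = f \<otimes> e"

definition left_identities :: "('a, 'b) monoid_scheme \<Rightarrow> 'a set \<Rightarrow> 'a \<Rightarrow> 'a set" where
  "left_identities S E x = {e \<in> E. x = e \<otimes>\<^bsub>S\<^esub> x}"

definition right_identities :: "('a, 'b) monoid_scheme \<Rightarrow> 'a set \<Rightarrow> 'a \<Rightarrow> 'a set" where
  "right_identities S E x = {e \<in> E. x = x \<otimes>\<^bsub>S\<^esub> e}"

definition R_rel :: "('a, 'b) monoid_scheme \<Rightarrow> 'a set \<Rightarrow> 'a rel" where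
  "R_rel S E = {(x, y). x \<in> carrier S \<and> y \<in> carrier S \<and>
      left_identities S E x = left_identities S E y}"

definition L_rel :: "('a, 'b) monoid_scheme \<Rightarrow> 'a set \<Rightarrow> 'a rel" where
  "L_rel S E = {(x, y). x \<in> carrier S \<and> y \<in> carrier S \<and>
      right_identities S E x = right_identities S E y}"

locale left_ehresmann = semigroup_with_semilattice S E for S (structure) and E +
  assumes L1: "C \<in> carrier S // R_rel S E \<Longrightarrow> \<exists>!e. e \<in> C \<inter> E"
    and L2: "\<lbrakk>a \<in> carrier S; (x, y) \<in> R_rel S E\<rbrakk> \<Longrightarrow> (a \<otimes> x, a \<otimes> y) \<in> R_rel S E"

locale right_ehresmann = semigroup_with_semilattice S E for S (structure) and E +
  assumes R1: "C \<in> carrier S // L_rel S E \<Longrightarrow> \<exists>!e. e \<in> C \<inter> E"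
    and R2: "\<lbrakk>a \<in> carrier S; (x, y) \<in> L_rel S E\<rbrakk> \<Longrightarrow> (x \<otimes> a, y \<otimes> a) \<in> L_rel S E"

locale ehresmann = left_ehresmann S E + right_ehresmann S E for S (structure) and E


section \<open>Partition monoids\<close>

text \<open>
  The set \<open>X \<union> X'\<close> is rendered as \<open>X <+> X\<close>: \<open>Inl x\<close> is the upper vertex \<open>x\<close> and
  \<open>Inr x\<close> is the lower vertex \<open>x'\<close>. The vertices of the product graph are
  those of \<open>X \<union> X'' \<union> X'\<close>.
\<close>

datatype 'a vertex = Upper 'a | Middle 'a | Lower 'a

definition outer_vertex :: "'a + 'a \<Rightarrow> 'a vertex" where
  "outer_vertex = case_sum Upper Lower"

definition first_vertex :: "'a + 'a \<Rightarrow> 'a vertex" where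
  "first_vertex = case_sum Upper Middle"

definition second_vertex :: "'a + 'a \<Rightarrow> 'a vertex" where
  "second_vertex = case_sum Middle Lower"

text \<open>
  A partition is represented by the graph in which any two vertices of a block are adjacent.
  Which graph with these connected components is chosen does not affect the product.
\<close>

definition block_edges :: "('a + 'a) set set \<Rightarrow> ('a + 'a) rel" where
  "block_edges \<alpha> = {(u, v). \<exists>A\<in>\<alpha>. u \<in> A \<and> v \<in> A}"

definition product_graph ::
    "('a + 'a) set set \<Rightarrow> ('a + 'a) set set \<Rightarrow> 'a vertex rel" where
  "product_graph \<alpha> \<beta> =
     map_prod first_vertex first_vertex ` block_edges \<alpha> \<union>
     map_prod second_vertex second_vertex ` block_edges \<beta>"

definition partition_mult ::
    "'a set \<Rightarrow> ('a + 'a) set set \<Rightarrow> ('a + 'a) set set \<Rightarrow> ('a + 'a) set set" where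
  "partition_mult X \<alpha> \<beta> = (X <+> X) //
     {(u, v). u \<in> X <+> X \<and> v \<in> X <+> X \<and>
        (outer_vertex u, outer_vertex v) \<in> (product_graph \<alpha> \<beta>)\<^sup>*}"

definition id_equiv :: "'a set \<Rightarrow> 'a rel \<Rightarrow> ('a + 'a) set set" where
  "id_equiv X \<epsilon> = {A <+> A | A. A \<in> X // \<epsilon>}"

definition partition_monoid :: "'a set \<Rightarrow> ('a + 'a) set set monoid" where
  "partition_monoid X =
     \<lparr>carrier = {\<alpha>. partition_on (X <+> X) \<alpha>},
      mult = partition_mult X,
      one = id_equiv X (Id_on X)\<rparr>"

definition transversal :: "'a set \<Rightarrow> ('a + 'a) set \<Rightarrow> bool" where
  "transversal X A \<longleftrightarrow> A \<inter> Inl ` X \<noteq> {} \<and> A \<inter> Inr ` X \<noteq> {}"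

definition part_dom :: "'a set \<Rightarrow> ('a + 'a) set set \<Rightarrow> 'a set" where
  "part_dom X \<alpha> = {x \<in> X. \<exists>A\<in>\<alpha>. transversal X A \<and> Inl x \<in> A}"

definition part_codom :: "'a set \<Rightarrow> ('a + 'a) set set \<Rightarrow> 'a set" where
  "part_codom X \<alpha> = {x \<in> X. \<exists>A\<in>\<alpha>. transversal X A \<and> Inr x \<in> A}"

definition dual_symmetric_inverse_monoid :: "'a set \<Rightarrow> ('a + 'a) set set monoid" where
  "dual_symmetric_inverse_monoid X =
     (partition_monoid X)\<lparr>carrier :=
        {\<alpha> \<in> carrier (partition_monoid X). part_dom X \<alpha> = X \<and> part_codom X \<alpha> = X}\<rparr>"

end

theory Submission
  imports Defs
begin

text \<open>
  A partition \<open>\<alpha>\<close> is determined by which subsets of \<open>X \<union> X'\<close> are unions of blocks. Writing such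
  a subset as \<open>P \<union> Q'\<close> turns \<open>\<alpha>\<close> into a binary relation \<open>\<Phi>(\<alpha>)\<close> on the power set of \<open>X\<close>. The idea
  is that \<open>\<Phi>\<close> embeds the partition monoid into the monoid of binary relations under composition:
  a union of connected components of the product graph is a choice of subsets \<open>P\<close>, \<open>Q\<close>, \<open>R\<close>
  of the three rows such that \<open>P \<union> Q'\<close> is a union of blocks of \<open>\<alpha>\<close> and \<open>Q \<union> R'\<close> one of
  \<open>\<beta>\<close>, so \<open>\<Phi>(\<alpha>\<beta>)\<close> is the composite of \<open>\<Phi>(\<alpha>)\<close> and \<open>\<Phi>(\<beta>)\<close> (lemma \<open>cut_rel_mult\<close>).

  Under \<open>\<Phi>\<close> the element \<open>id\<^sub>\<epsilon>\<close> becomes the identity relation on the \<open>\<epsilon>\<close>-saturated sets, and the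
  domain of \<open>\<Phi>(\<alpha>)\<close> consists of the sets saturated for the equivalence that \<open>\<alpha>\<close> induces on the
  upper row; likewise for the range and the lower row. Thus the image of \<open>\<P>\<^sub>X\<close> is a semigroup of
  binary relations that contains, with each relation, the identities on its domain and on its
  range, and any such semigroup is Ehresmann over these partial identities: a partial identity
  fixes a relation from the left iff it contains the domain, and the domain of a composite
  depends on the second factor only through the domain of that factor.

  If all blocks of \<open>\<alpha>\<close> are transversals, either half of a union of blocks determines the other, so
  \<open>\<Phi>(\<alpha>)\<close> is a partial injection. An idempotent partial injection is a partial identity, and
  \<open>\<Phi>(\<alpha>)\<close> is a partial identity only when \<open>\<alpha>\<close> is some \<open>id\<^sub>\<epsilon>\<close>.
\<close>

section \<open>Ehresmann semigroups of binary relations\<close>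

lemma partial_identity_relcomp:
  assumes "e \<subseteq> Id"
  shows "r = e O r \<longleftrightarrow> Domain r \<subseteq> Domain e" "r = r O e \<longleftrightarrow> Range r \<subseteq> Range e"
proof -
  have e: "(a, b) \<in> e \<longleftrightarrow> a = b \<and> a \<in> Domain e" "a \<in> Range e \<longleftrightarrow> a \<in> Domain e" for a b
    using assms by blast+
  have "e O r = {(a, b) \<in> r. a \<in> Domain e}" "r O e = {(a, b) \<in> r. b \<in> Range e}"
    unfolding relcomp_unfold e by auto
  then show "r = e O r \<longleftrightarrow> Domain r \<subseteq> Domain e" "r = r O e \<longleftrightarrow> Range r \<subseteq> Range e"
    by (auto simp del: Domain_iff Range_iff; blast)+
qed

text \<open>
  Associativity of \<open>S\<close> and the semilattice laws of \<open>E\<close> are reflected along the injective \<open>\<Phi>\<close>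
  from composition of relations, which is associative and under which partial identities are
  idempotent and commute.
\<close>

locale relational_representation =
  fixes S (structure) and E and \<Phi> :: "'a \<Rightarrow> 'b rel"
  assumes S_closed: "\<lbrakk>x \<in> carrier S; y \<in> carrier S\<rbrakk> \<Longrightarrow> x \<otimes> y \<in> carrier S"
    and inj: "inj_on \<Phi> (carrier S)"
    and hom: "\<lbrakk>x \<in> carrier S; y \<in> carrier S\<rbrakk> \<Longrightarrow> \<Phi> (x \<otimes> y) = \<Phi> x O \<Phi> y"
    and E_carrier: "E \<subseteq> carrier S"
    and E_mult: "\<lbrakk>e \<in> E; f \<in> E\<rbrakk> \<Longrightarrow> e \<otimes> f \<in> E"
    and E_Id: "e \<in> E \<Longrightarrow> \<Phi> e \<subseteq> Id"
    and domain_id: "x \<in> carrier S \<Longrightarrow> \<exists>e\<in>E. \<Phi> e = Id_on (Domain (\<Phi> x))"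
    and range_id: "x \<in> carrier S \<Longrightarrow> \<exists>e\<in>E. \<Phi> e = Id_on (Range (\<Phi> x))"
begin

lemma eq_iff: "\<lbrakk>x \<in> carrier S; y \<in> carrier S\<rbrakk> \<Longrightarrow> x = y \<longleftrightarrow> \<Phi> x = \<Phi> y"
  using inj by (auto dest: inj_onD)

lemma in_carrier: "e \<in> E \<Longrightarrow> e \<in> carrier S"
  using E_carrier by blast

lemma partial_identity_eq_iff:
  assumes "e \<in> E" "f \<in> E"
  shows "e = f \<longleftrightarrow> Domain (\<Phi> e) = Domain (\<Phi> f)"
proof -
  have "\<Phi> e = \<Phi> f" if "Domain (\<Phi> e) = Domain (\<Phi> f)"
    using that E_Id[OF assms(1)] E_Id[OF assms(2)] by blast
  then show ?thesis
    using eq_iff assms in_carrier by blast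
qed

lemma partial_identity_Range: "e \<in> E \<Longrightarrow> Range (\<Phi> e) = Domain (\<Phi> e)"
  using E_Id by blast

lemma semigroup_with_semilattice: "semigroup_with_semilattice S E"
proof
  fix x y z assume "x \<in> carrier S" "y \<in> carrier S" "z \<in> carrier S"
  then show "(x \<otimes> y) \<otimes> z = x \<otimes> (y \<otimes> z)"
    by (subst eq_iff) (auto simp: hom S_closed)
next
  have "e \<otimes> e = e" if "e \<in> E" for e
  proof -
    have "\<Phi> e O \<Phi> e = \<Phi> e"
      using E_Id[OF that] by blast
    then show ?thesis
      using that by (subst eq_iff) (simp_all add: hom S_closed in_carrier)
  qed
  then show "E \<subseteq> idempotents S"
    using in_carrier by (auto simp: idempotents_def)
next
  fix e f assume ef: "e \<in> E" "f \<in> E"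
  have "\<Phi> e O \<Phi> f = \<Phi> f O \<Phi> e"
    using E_Id[OF ef(1)] E_Id[OF ef(2)] by blast
  then show "e \<otimes> f = f \<otimes> e"
    using ef by (subst eq_iff) (simp_all add: hom S_closed in_carrier)
qed (simp_all add: S_closed E_mult)

lemma left_identities_eq:
  assumes "x \<in> carrier S"
  shows "left_identities S E x = {e \<in> E. Domain (\<Phi> x) \<subseteq> Domain (\<Phi> e)}"
proof -
  have "x = e \<otimes> x \<longleftrightarrow> Domain (\<Phi> x) \<subseteq> Domain (\<Phi> e)" if "e \<in> E" for e
  proof -
    have "x = e \<otimes> x \<longleftrightarrow> \<Phi> x = \<Phi> e O \<Phi> x"
      using assms that by (subst eq_iff) (simp_all add: hom S_closed in_carrier)
    also have "\<dots> \<longleftrightarrow> Domain (\<Phi> x) \<subseteq> Domain (\<Phi> e)"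
      using E_Id[OF that] by (rule partial_identity_relcomp)
    finally show ?thesis .
  qed
  then show ?thesis
    by (auto simp: left_identities_def)
qed

lemma right_identities_eq:
  assumes "x \<in> carrier S"
  shows "right_identities S E x = {e \<in> E. Range (\<Phi> x) \<subseteq> Range (\<Phi> e)}"
proof -
  have "x = x \<otimes> e \<longleftrightarrow> Range (\<Phi> x) \<subseteq> Range (\<Phi> e)" if "e \<in> E" for e
  proof -
    have "x = x \<otimes> e \<longleftrightarrow> \<Phi> x = \<Phi> x O \<Phi> e"
      using assms that by (subst eq_iff) (simp_all add: hom S_closed in_carrier)
    also have "\<dots> \<longleftrightarrow> Range (\<Phi> x) \<subseteq> Range (\<Phi> e)"
      using E_Id[OF that] by (rule partial_identity_relcomp)
    finally show ?thesis .
  qed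
  then show ?thesis
    by (auto simp: right_identities_def)
qed

text \<open>
  The sets of left identities recover the domains because \<open>E\<close> contains the smallest candidate,
  the identity on the domain itself.
\<close>

lemma R_rel_iff:
  "(x, y) \<in> R_rel S E \<longleftrightarrow> x \<in> carrier S \<and> y \<in> carrier S \<and> Domain (\<Phi> x) = Domain (\<Phi> y)"
proof -
  have "Domain (\<Phi> x) = Domain (\<Phi> y)"
    if xy: "x \<in> carrier S" "y \<in> carrier S" "left_identities S E x = left_identities S E y"
  proof -
    obtain e f where "e \<in> E" "\<Phi> e = Id_on (Domain (\<Phi> x))"
      "f \<in> E" "\<Phi> f = Id_on (Domain (\<Phi> y))"
      using domain_id xy by metis
    moreover have "Domain (\<Phi> x) \<subseteq> Domain (\<Phi> g) \<longleftrightarrow> Domain (\<Phi> y) \<subseteq> Domain (\<Phi> g)" if "g \<in> E" for g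
      using that xy(3) unfolding left_identities_eq[OF xy(1)] left_identities_eq[OF xy(2)] by blast
    ultimately show ?thesis
      by (metis Domain_Id_on subset_antisym subset_refl)
  qed
  then show ?thesis
    using left_identities_eq[of x] left_identities_eq[of y]
    unfolding R_rel_def mem_Collect_eq prod.case by metis
qed

lemma L_rel_iff:
  "(x, y) \<in> L_rel S E \<longleftrightarrow> x \<in> carrier S \<and> y \<in> carrier S \<and> Range (\<Phi> x) = Range (\<Phi> y)"
proof -
  have "Range (\<Phi> x) = Range (\<Phi> y)"
    if xy: "x \<in> carrier S" "y \<in> carrier S" "right_identities S E x = right_identities S E y"
  proof -
    obtain e f where "e \<in> E" "\<Phi> e = Id_on (Range (\<Phi> x))"
      "f \<in> E" "\<Phi> f = Id_on (Range (\<Phi> y))"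
      using range_id xy by metis
    moreover have "Range (\<Phi> x) \<subseteq> Range (\<Phi> g) \<longleftrightarrow> Range (\<Phi> y) \<subseteq> Range (\<Phi> g)" if "g \<in> E" for g
      using that xy(3) unfolding right_identities_eq[OF xy(1)] right_identities_eq[OF xy(2)] by blast
    ultimately show ?thesis
      by (metis Range_Id_on subset_antisym subset_refl)
  qed
  then show ?thesis
    using right_identities_eq[of x] right_identities_eq[of y]
    unfolding L_rel_def mem_Collect_eq prod.case by metis
qed

text \<open>
  The congruence conditions hold because the domain of a composite \<open>r O s\<close> is the preimage under
  \<open>r\<close> of the domain of \<open>s\<close>, and dually for ranges.
\<close>

lemma ehresmann: "ehresmann S E"
proof -
  interpret semigroup_with_semilattice S E
    by (rule semigroup_with_semilattice)
  show ?thesis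
  proof
    fix C assume "C \<in> carrier S // R_rel S E"
    then obtain x where x: "x \<in> carrier S" and C: "C = R_rel S E `` {x}"
      by (auto simp: quotient_def)
    have in_C: "e \<in> C \<inter> E \<longleftrightarrow> e \<in> E \<and> Domain (\<Phi> e) = Domain (\<Phi> x)" for e
      using x by (auto simp: C R_rel_iff in_carrier)
    obtain e where "e \<in> E" "\<Phi> e = Id_on (Domain (\<Phi> x))"
      using domain_id[OF x] by blast
    then show "\<exists>!e. e \<in> C \<inter> E"
      unfolding in_C by (intro ex1I[of _ e]) (auto simp: partial_identity_eq_iff)
  next
    fix C assume "C \<in> carrier S // L_rel S E"
    then obtain x where x: "x \<in> carrier S" and C: "C = L_rel S E `` {x}"
      by (auto simp: quotient_def)
    have in_C: "e \<in> C \<inter> E \<longleftrightarrow> e \<in> E \<and> Domain (\<Phi> e) = Range (\<Phi> x)" for e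
      using x by (cases "e \<in> E")
        (simp_all add: C L_rel_iff in_carrier partial_identity_Range eq_commute)
    obtain e where "e \<in> E" "\<Phi> e = Id_on (Range (\<Phi> x))"
      using range_id[OF x] by blast
    then show "\<exists>!e. e \<in> C \<inter> E"
      unfolding in_C by (intro ex1I[of _ e]) (auto simp: partial_identity_eq_iff)
  next
    fix a x y assume "a \<in> carrier S" "(x, y) \<in> R_rel S E"
    moreover have "Domain (r O s) = r\<inverse> `` Domain s" for r s :: "'b rel"
      by blast
    ultimately show "(a \<otimes> x, a \<otimes> y) \<in> R_rel S E"
      by (simp add: R_rel_iff S_closed hom)
  next
    fix a x y assume "a \<in> carrier S" "(x, y) \<in> L_rel S E"
    moreover have "Range (r O s) = s `` Range r" for r s :: "'b rel"
      by blast
    ultimately show "(x \<otimes> a, y \<otimes> a) \<in> L_rel S E"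
      by (simp add: L_rel_iff S_closed hom)
  qed
qed

end

section \<open>Partitions as binary relations on the power set\<close>

lemma block_edges_in:
  assumes "partition_on V \<alpha>" "(u, v) \<in> block_edges \<alpha>"
  shows "u \<in> V" "v \<in> V"
  using assms by (auto simp: block_edges_def partition_on_def)

lemma equiv_block_edges: "partition_on V \<alpha> \<Longrightarrow> equiv V (block_edges \<alpha>)"
  using equiv_partition_on by (auto simp: block_edges_def)

lemma quotient_block_edges: "partition_on V \<alpha> \<Longrightarrow> V // block_edges \<alpha> = \<alpha>"
  using partition_on_eq_quotient by (auto simp: block_edges_def)

lemma common_class_iff:
  assumes "equiv V r"
  shows "(\<exists>A\<in>V // r. u \<in> A \<and> v \<in> A) \<longleftrightarrow> (u, v) \<in> r"
proof
  assume "\<exists>A\<in>V // r. u \<in> A \<and> v \<in> A"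
  then show "(u, v) \<in> r"
    using quotient_eq_iff[OF assms] by blast
next
  assume uv: "(u, v) \<in> r"
  then have "u \<in> V"
    using assms by (auto simp: equiv_def refl_on_def)
  then show "\<exists>A\<in>V // r. u \<in> A \<and> v \<in> A"
    using uv quotientI[of u V r] equiv_class_self[OF assms] by blast
qed

lemma block_edges_quotient: "equiv V r \<Longrightarrow> block_edges (V // r) = r"
  by (simp add: block_edges_def common_class_iff)

definition saturated_sets :: "'a set \<Rightarrow> 'a rel \<Rightarrow> 'a set set" where
  "saturated_sets X r = {P. P \<subseteq> X \<and> r `` P \<subseteq> P}"

text \<open>
  This is the relation \<open>\<Phi>(\<alpha>)\<close>: the sets saturated for \<open>block_edges \<alpha>\<close> are the unions of blocks
  when \<open>\<alpha>\<close> is a partition, and each is cut into its upper and its lower half.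
\<close>

definition cut_rel :: "'a set \<Rightarrow> ('a + 'a) set set \<Rightarrow> 'a set rel" where
  "cut_rel X \<alpha> = {(P, Q). P <+> Q \<in> saturated_sets (X <+> X) (block_edges \<alpha>)}"

lemma set_eq_Plus: "U = Inl -` U <+> Inr -` U"
proof (rule Set.set_eqI)
  fix v show "v \<in> U \<longleftrightarrow> v \<in> Inl -` U <+> Inr -` U"
    by (cases v) auto
qed

lemma cut_rel_iff:
  "(P, Q) \<in> cut_rel X \<alpha> \<longleftrightarrow> P \<subseteq> X \<and> Q \<subseteq> X \<and>
     (\<forall>u v. (u, v) \<in> block_edges \<alpha> \<longrightarrow> u \<in> P <+> Q \<longrightarrow> v \<in> P <+> Q)"
proof -
  have "P <+> Q \<subseteq> X <+> X \<longleftrightarrow> P \<subseteq> X \<and> Q \<subseteq> X"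
    by blast
  then show ?thesis
    unfolding cut_rel_def saturated_sets_def by blast
qed

lemma Image_saturated:
  assumes "equiv V r"
  shows "r `` A \<in> saturated_sets V r"
proof -
  have "r `` A \<subseteq> V"
    using equiv_type[OF assms] by blast
  moreover have "r `` r `` A \<subseteq> r `` A"
    using assms unfolding equiv_def trans_def by blast
  ultimately show ?thesis
    by (simp add: saturated_sets_def)
qed

text \<open>
  An equivalence is recovered from its saturated sets, since the class of a point is the smallest
  saturated set that contains it; fewer saturated sets mean a coarser equivalence.
\<close>

lemma saturated_sets_anti:
  assumes "equiv V r" "saturated_sets V s \<subseteq> saturated_sets V r" "equiv V s"
  shows "r \<subseteq> s"
proof (rule subrelI)
  fix u v assume uv: "(u, v) \<in> r"
  then have u: "u \<in> V"
    using assms(1) by (auto simp: equiv_def refl_on_def)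
  have "s `` {u} \<in> saturated_sets V r"
    using Image_saturated[OF assms(3)] assms(2) by blast
  moreover have "u \<in> s `` {u}"
    using assms(3) u by (auto simp: equiv_def refl_on_def)
  ultimately show "(u, v) \<in> s"
    using uv by (auto simp: saturated_sets_def)
qed

lemma inj_on_cut_rel: "inj_on (cut_rel X) {\<alpha>. partition_on (X <+> X) \<alpha>}"
proof (rule inj_onI)
  fix \<alpha> \<beta> assume "\<alpha> \<in> {\<alpha>. partition_on (X <+> X) \<alpha>}" "\<beta> \<in> {\<alpha>. partition_on (X <+> X) \<alpha>}"
    and eq: "cut_rel X \<alpha> = cut_rel X \<beta>"
  then have parts: "partition_on (X <+> X) \<alpha>" "partition_on (X <+> X) \<beta>"
    by auto
  have "saturated_sets (X <+> X) (block_edges \<alpha>) = saturated_sets (X <+> X) (block_edges \<beta>)"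
  proof -
    have "U \<in> saturated_sets (X <+> X) (block_edges \<gamma>) \<longleftrightarrow> (Inl -` U, Inr -` U) \<in> cut_rel X \<gamma>"
      for U \<gamma>
      by (simp add: cut_rel_def flip: set_eq_Plus)
    then show ?thesis
      using eq by blast
  qed
  then have "block_edges \<alpha> = block_edges \<beta>"
    using parts[THEN equiv_block_edges] by (simp add: subset_antisym saturated_sets_anti)
  then show "\<alpha> = \<beta>"
    using quotient_block_edges parts by metis
qed

section \<open>The product as composition of relations\<close>

lemma equiv_product:
  fixes X :: "'a set"
  shows
  "equiv (X <+> X) {(u, v). u \<in> X <+> X \<and> v \<in> X <+> X \<and>
     (outer_vertex u, outer_vertex v) \<in> (product_graph \<alpha> \<beta>)\<^sup>*}"
proof -
  have edges: "sym (block_edges \<gamma>)" for \<gamma> :: "('a + 'a) set set"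
    by (auto simp: sym_def block_edges_def)
  have image: "sym (map_prod f f ` r)" if "sym r" for f :: "'a + 'a \<Rightarrow> 'a vertex" and r
  proof (rule symI)
    fix p q assume "(p, q) \<in> map_prod f f ` r"
    then obtain u v where "(u, v) \<in> r" "p = f u" "q = f v"
      by auto
    moreover from this have "(v, u) \<in> r"
      using that by (blast dest: symD)
    ultimately show "(q, p) \<in> map_prod f f ` r"
      by (metis imageI map_prod_simp)
  qed
  have "sym (product_graph \<alpha> \<beta>)"
    unfolding product_graph_def by (intro sym_Un image edges)
  then have "sym ((product_graph \<alpha> \<beta>)\<^sup>*)"
    by (rule sym_rtrancl)
  then show ?thesis
    unfolding equiv_def refl_on_def
    by (auto intro!: symI transI dest: symD intro: rtrancl_trans)
qed

lemma partition_on_mult: "partition_on (X <+> X) (partition_mult X \<alpha> \<beta>)"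
  unfolding partition_mult_def using equiv_product by (rule partition_on_quotient)

lemma block_edges_mult:
  "block_edges (partition_mult X \<alpha> \<beta>) = {(u, v). u \<in> X <+> X \<and> v \<in> X <+> X \<and>
     (outer_vertex u, outer_vertex v) \<in> (product_graph \<alpha> \<beta>)\<^sup>*}"
  unfolding partition_mult_def using equiv_product by (rule block_edges_quotient)

text \<open>
  For the inclusion from left to right the middle set consists of the middle vertices reachable
  from the given union of blocks of the product; for the converse, the three sets together are
  closed under the edges of the product graph, hence under its paths.
\<close>

lemma cut_rel_mult:
  assumes \<alpha>: "partition_on (X <+> X) \<alpha>" and \<beta>: "partition_on (X <+> X) \<beta>"
  shows "cut_rel X (partition_mult X \<alpha> \<beta>) = cut_rel X \<alpha> O cut_rel X \<beta>"
proof (intro subset_antisym subrelI)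
  let ?G = "product_graph \<alpha> \<beta>"
  fix P R assume PR: "(P, R) \<in> cut_rel X (partition_mult X \<alpha> \<beta>)"
  define U where "U = ?G\<^sup>* `` (outer_vertex ` (P <+> R))"
  define Q where "Q = {x \<in> X. Middle x \<in> U}"
  have sub: "P \<subseteq> X" "R \<subseteq> X"
    using PR by (auto simp: cut_rel_iff)
  have U_step: "q \<in> U" if "p \<in> U" "(p, q) \<in> ?G" for p q
    using that unfolding U_def by (auto intro: rtrancl_into_rtrancl)
  \<comment> \<open>Since \<open>P <+> R\<close> is a union of blocks of the product, the paths add no further outer vertex.\<close>
  have outer: "outer_vertex v \<in> U \<longleftrightarrow> v \<in> P <+> R" if "v \<in> X <+> X" for v
  proof
    assume "outer_vertex v \<in> U"
    then obtain u where u: "u \<in> P <+> R" "(outer_vertex u, outer_vertex v) \<in> ?G\<^sup>*"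
      by (auto simp only: U_def Image_iff)
    moreover have "u \<in> X <+> X"
      using u(1) sub by blast
    ultimately show "v \<in> P <+> R"
      using PR that by (simp add: cut_rel_iff block_edges_mult)
  qed (auto simp: U_def)
  have Upper: "Upper x \<in> U \<longleftrightarrow> x \<in> P" and Lower: "Lower x \<in> U \<longleftrightarrow> x \<in> R" if "x \<in> X" for x
    using outer[of "Inl x"] outer[of "Inr x"] that by (auto simp: outer_vertex_def)
  have first: "first_vertex v \<in> U \<longleftrightarrow> v \<in> P <+> Q"
    and second: "second_vertex v \<in> U \<longleftrightarrow> v \<in> Q <+> R" if "v \<in> X <+> X" for v
    using that by (auto simp: first_vertex_def second_vertex_def Q_def Upper Lower)
  have "(P, Q) \<in> cut_rel X \<alpha>"
    unfolding cut_rel_iff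
  proof (intro conjI allI impI)
    fix u v assume uv: "(u, v) \<in> block_edges \<alpha>" "u \<in> P <+> Q"
    have "(first_vertex u, first_vertex v) \<in> ?G"
      using uv(1) by (force simp: product_graph_def)
    then show "v \<in> P <+> Q"
      using uv first U_step block_edges_in[OF \<alpha> uv(1)] by blast
  qed (use sub Q_def in auto)
  moreover have "(Q, R) \<in> cut_rel X \<beta>"
    unfolding cut_rel_iff
  proof (intro conjI allI impI)
    fix u v assume uv: "(u, v) \<in> block_edges \<beta>" "u \<in> Q <+> R"
    have "(second_vertex u, second_vertex v) \<in> ?G"
      using uv(1) by (force simp: product_graph_def)
    then show "v \<in> Q <+> R"
      using uv second U_step block_edges_in[OF \<beta> uv(1)] by blast
  qed (use sub Q_def in auto)
  ultimately show "(P, R) \<in> cut_rel X \<alpha> O cut_rel X \<beta>"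
    by blast
next
  let ?G = "product_graph \<alpha> \<beta>"
  fix P R assume "(P, R) \<in> cut_rel X \<alpha> O cut_rel X \<beta>"
  then obtain Q where PQ: "(P, Q) \<in> cut_rel X \<alpha>" and QR: "(Q, R) \<in> cut_rel X \<beta>"
    by blast
  define U where "U = Upper ` P \<union> Middle ` Q \<union> Lower ` R"
  have first: "first_vertex v \<in> U \<longleftrightarrow> v \<in> P <+> Q"
    and second: "second_vertex v \<in> U \<longleftrightarrow> v \<in> Q <+> R"
    and outer: "outer_vertex v \<in> U \<longleftrightarrow> v \<in> P <+> R" for v
    by (cases v; auto simp: first_vertex_def second_vertex_def outer_vertex_def U_def)+
  have step: "q \<in> U" if "(p, q) \<in> ?G" "p \<in> U" for p q
    using that PQ QR
    by (auto simp: product_graph_def cut_rel_iff first second)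
  have path: "q \<in> U" if "(p, q) \<in> ?G\<^sup>*" "p \<in> U" for p q
    using that by (induction rule: rtrancl_induct) (auto intro: step)
  have "v \<in> P <+> R" if "(u, v) \<in> block_edges (partition_mult X \<alpha> \<beta>)" "u \<in> P <+> R" for u v
    using that path unfolding block_edges_mult by (auto simp flip: outer)
  then show "(P, R) \<in> cut_rel X (partition_mult X \<alpha> \<beta>)"
    using PQ QR by (simp add: cut_rel_iff)
qed

section \<open>Domains, ranges and partial identities\<close>

definition upper_kernel :: "('a + 'a) set set \<Rightarrow> 'a rel" where
  "upper_kernel \<alpha> = {(x, y). (Inl x, Inl y) \<in> block_edges \<alpha>}"

definition lower_kernel :: "('a + 'a) set set \<Rightarrow> 'a rel" where
  "lower_kernel \<alpha> = {(x, y). (Inr x, Inr y) \<in> block_edges \<alpha>}"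

lemma equiv_kernels:
  assumes "partition_on (X <+> X) \<alpha>"
  shows "equiv X (upper_kernel \<alpha>)" "equiv X (lower_kernel \<alpha>)"
  using equiv_block_edges[OF assms]
  unfolding equiv_def refl_on_def sym_def trans_def upper_kernel_def lower_kernel_def
  by blast+

text \<open>
  A set saturated for the kernel extends to a union of blocks by adjoining the vertices of the
  other row that lie in a common block with one of its elements.
\<close>

lemma Domain_cut_rel:
  assumes "partition_on (X <+> X) \<alpha>"
  shows "Domain (cut_rel X \<alpha>) = saturated_sets X (upper_kernel \<alpha>)"
proof (intro subset_antisym subsetI)
  fix P assume P: "P \<in> saturated_sets X (upper_kernel \<alpha>)"
  define U where "U = block_edges \<alpha> `` (Inl ` P)"
  have "(v, v) \<in> block_edges \<alpha>" if "v \<in> X <+> X" for v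
    using that equiv_block_edges[OF assms] by (simp add: equiv_def refl_on_def)
  then have "P \<subseteq> Inl -` U"
    using P unfolding U_def saturated_sets_def by blast
  moreover have "Inl -` U \<subseteq> P"
    using P unfolding U_def saturated_sets_def upper_kernel_def by blast
  moreover have "U \<in> saturated_sets (X <+> X) (block_edges \<alpha>)"
    unfolding U_def by (rule Image_saturated[OF equiv_block_edges[OF assms]])
  ultimately have "(P, Inr -` U) \<in> cut_rel X \<alpha>"
    using set_eq_Plus[of U] by (simp add: cut_rel_def subset_antisym)
  then show "P \<in> Domain (cut_rel X \<alpha>)"
    by blast
next
  fix P assume "P \<in> Domain (cut_rel X \<alpha>)"
  then show "P \<in> saturated_sets X (upper_kernel \<alpha>)"
    unfolding saturated_sets_def upper_kernel_def cut_rel_iff Domain_iff by blast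
qed

lemma Range_cut_rel:
  assumes "partition_on (X <+> X) \<alpha>"
  shows "Range (cut_rel X \<alpha>) = saturated_sets X (lower_kernel \<alpha>)"
proof (intro subset_antisym subsetI)
  fix Q assume Q: "Q \<in> saturated_sets X (lower_kernel \<alpha>)"
  define U where "U = block_edges \<alpha> `` (Inr ` Q)"
  have "(v, v) \<in> block_edges \<alpha>" if "v \<in> X <+> X" for v
    using that equiv_block_edges[OF assms] by (simp add: equiv_def refl_on_def)
  then have "Q \<subseteq> Inr -` U"
    using Q unfolding U_def saturated_sets_def by blast
  moreover have "Inr -` U \<subseteq> Q"
    using Q unfolding U_def saturated_sets_def lower_kernel_def by blast
  moreover have "U \<in> saturated_sets (X <+> X) (block_edges \<alpha>)"
    unfolding U_def by (rule Image_saturated[OF equiv_block_edges[OF assms]])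
  ultimately have "(Inl -` U, Q) \<in> cut_rel X \<alpha>"
    using set_eq_Plus[of U] by (simp add: cut_rel_def subset_antisym)
  then show "Q \<in> Range (cut_rel X \<alpha>)"
    by blast
next
  fix Q assume "Q \<in> Range (cut_rel X \<alpha>)"
  then show "Q \<in> saturated_sets X (lower_kernel \<alpha>)"
    unfolding saturated_sets_def lower_kernel_def cut_rel_iff Range_iff by blast
qed

lemma partition_on_id_equiv:
  assumes "equiv X \<epsilon>"
  shows "partition_on (X <+> X) (id_equiv X \<epsilon>)"
proof (rule partition_onI)
  note parts = partition_on_quotient[OF assms]
  show "\<Union> (id_equiv X \<epsilon>) = X <+> X"
  proof (rule Set.set_eqI)
    fix v
    have "v \<in> \<Union> (id_equiv X \<epsilon>) \<longleftrightarrow> (\<exists>A \<in> X // \<epsilon>. v \<in> A <+> A)"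
      unfolding id_equiv_def by blast
    also have "\<dots> \<longleftrightarrow> v \<in> \<Union> (X // \<epsilon>) <+> \<Union> (X // \<epsilon>)"
      by (cases v) blast+
    finally show "v \<in> \<Union> (id_equiv X \<epsilon>) \<longleftrightarrow> v \<in> X <+> X"
      using partition_onD1[OF parts] by simp
  qed
  show "{} \<notin> id_equiv X \<epsilon>"
  proof
    assume "{} \<in> id_equiv X \<epsilon>"
    then obtain A where "A \<in> X // \<epsilon>" "{} = A <+> A"
      unfolding id_equiv_def by blast
    then show False
      using partition_onD3[OF parts] Plus_eq_empty_conv[of A A] by metis
  qed
  fix p q assume "p \<in> id_equiv X \<epsilon>" "q \<in> id_equiv X \<epsilon>" "p \<noteq> q"
  then obtain A B where "A \<in> X // \<epsilon>" "B \<in> X // \<epsilon>" "p = A <+> A" "q = B <+> B" "A \<noteq> B"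
    unfolding id_equiv_def by blast
  moreover from this have "A \<inter> B = {}"
    using quotient_disj[OF assms] by blast
  ultimately show "disjnt p q"
    unfolding disjnt_def by blast
qed

text \<open>
  Both rows of \<open>id\<^sub>\<epsilon>\<close> are glued along \<open>x \<mapsto> x'\<close>, so two vertices share a block iff their images
  under the folding map \<open>\<pi>\<close> onto \<open>X\<close> are \<open>\<epsilon>\<close>-related.
\<close>

lemma cut_rel_id_equiv:
  assumes "equiv X \<epsilon>"
  shows "cut_rel X (id_equiv X \<epsilon>) = Id_on (saturated_sets X \<epsilon>)"
proof -
  define \<pi> :: "'a + 'a \<Rightarrow> 'a" where "\<pi> = case_sum id id"
  have "(u, v) \<in> block_edges (id_equiv X \<epsilon>) \<longleftrightarrow> (\<exists>A \<in> X // \<epsilon>. \<pi> u \<in> A \<and> \<pi> v \<in> A)" for u v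
    by (cases u; cases v) (auto simp: block_edges_def id_equiv_def \<pi>_def)
  also have "\<dots> u v \<longleftrightarrow> (\<pi> u, \<pi> v) \<in> \<epsilon>" for u v
    by (rule common_class_iff[OF assms])
  finally have edges: "(u, v) \<in> block_edges (id_equiv X \<epsilon>) \<longleftrightarrow> (\<pi> u, \<pi> v) \<in> \<epsilon>" for u v .
  have refl: "(x, x) \<in> \<epsilon>" if "x \<in> X" for x
    using assms that by (auto simp: equiv_def refl_on_def)
  show ?thesis
  proof (intro subset_antisym subrelI)
    fix P Q assume PQ: "(P, Q) \<in> cut_rel X (id_equiv X \<epsilon>)"
    then have closed: "v \<in> P <+> Q" if "(\<pi> u, \<pi> v) \<in> \<epsilon>" "u \<in> P <+> Q" for u v
      using that by (auto simp: cut_rel_iff edges)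
    have sub: "P \<subseteq> X" "Q \<subseteq> X"
      using PQ by (auto simp: cut_rel_iff)
    \<comment> \<open>Each \<open>x\<close> lies in a common block with its copy \<open>x'\<close>.\<close>
    have "P = Q"
    proof (rule Set.set_eqI)
      fix x
      show "x \<in> P \<longleftrightarrow> x \<in> Q"
        using closed[of "Inl x" "Inr x"] closed[of "Inr x" "Inl x"] sub refl[of x]
        by (auto simp: \<pi>_def)
    qed
    moreover have "P \<in> saturated_sets X \<epsilon>"
      using closed[of "Inl x" "Inl y" for x y] sub by (auto simp: saturated_sets_def \<pi>_def)
    ultimately show "(P, Q) \<in> Id_on (saturated_sets X \<epsilon>)"
      by auto
  next
    fix P Q assume "(P, Q) \<in> Id_on (saturated_sets X \<epsilon>)"
    then show "(P, Q) \<in> cut_rel X (id_equiv X \<epsilon>)"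
      by (auto simp: cut_rel_iff edges saturated_sets_def \<pi>_def split: sum.splits)
  qed
qed

text \<open>
  A partial identity is determined by its domain, so \<open>\<alpha>\<close> must be the partition \<open>id\<^sub>\<epsilon>\<close> for its upper
  kernel \<open>\<epsilon>\<close>. This also shows that a product \<open>id\<^sub>\<epsilon> id\<^sub>\<eta>\<close> is again of this form, without
  describing the join of \<open>\<epsilon>\<close> and \<open>\<eta>\<close>.
\<close>

lemma id_equiv_upper_kernel:
  assumes "partition_on (X <+> X) \<alpha>" "cut_rel X \<alpha> \<subseteq> Id"
  shows "\<alpha> = id_equiv X (upper_kernel \<alpha>)"
proof -
  note ker = equiv_kernels(1)[OF assms(1)]
  have "cut_rel X \<alpha> = Id_on (Domain (cut_rel X \<alpha>))"
    using assms(2) by blast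
  also have "\<dots> = cut_rel X (id_equiv X (upper_kernel \<alpha>))"
    by (simp add: Domain_cut_rel[OF assms(1)] cut_rel_id_equiv[OF ker])
  finally show ?thesis
    using inj_onD[OF inj_on_cut_rel] assms(1) partition_on_id_equiv[OF ker] by blast
qed

section \<open>The Ehresmann structure and the idempotents\<close>

lemma relational_representation_partition_monoid:
  "relational_representation (partition_monoid X) {id_equiv X \<epsilon> | \<epsilon>. equiv X \<epsilon>} (cut_rel X)"
proof
  let ?S = "partition_monoid X" and ?F = "{id_equiv X \<epsilon> | \<epsilon>. equiv X \<epsilon>}"
  show "inj_on (cut_rel X) (carrier ?S)"
    using inj_on_cut_rel by (simp add: partition_monoid_def)
  show "?F \<subseteq> carrier ?S"
    by (auto simp: partition_monoid_def partition_on_id_equiv)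
  show "cut_rel X e \<subseteq> Id" if "e \<in> ?F" for e
    using that by (auto simp: cut_rel_id_equiv)
  show "e \<otimes>\<^bsub>?S\<^esub> f \<in> ?F" if ef: "e \<in> ?F" "f \<in> ?F" for e f
  proof -
    have "cut_rel X (partition_mult X e f) \<subseteq> Id"
      using ef by (auto simp: cut_rel_mult partition_on_id_equiv cut_rel_id_equiv)
    then show ?thesis
      using id_equiv_upper_kernel[OF partition_on_mult] equiv_kernels(1)[OF partition_on_mult]
      by (simp add: partition_monoid_def) blast
  qed
next
  fix \<alpha> assume "\<alpha> \<in> carrier (partition_monoid X)"
  then have \<alpha>: "partition_on (X <+> X) \<alpha>"
    by (simp add: partition_monoid_def)
  show "\<exists>e\<in>{id_equiv X \<epsilon> | \<epsilon>. equiv X \<epsilon>}. cut_rel X e = Id_on (Domain (cut_rel X \<alpha>))"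
    using equiv_kernels(1)[OF \<alpha>] cut_rel_id_equiv Domain_cut_rel[OF \<alpha>] by fastforce
  show "\<exists>e\<in>{id_equiv X \<epsilon> | \<epsilon>. equiv X \<epsilon>}. cut_rel X e = Id_on (Range (cut_rel X \<alpha>))"
    using equiv_kernels(2)[OF \<alpha>] cut_rel_id_equiv Range_cut_rel[OF \<alpha>] by fastforce
qed (simp_all add: partition_monoid_def partition_on_mult cut_rel_mult)

lemma id_equiv_full_domain:
  assumes "equiv X \<epsilon>"
  shows "part_dom X (id_equiv X \<epsilon>) = X" "part_codom X (id_equiv X \<epsilon>) = X"
proof -
  have "\<exists>A\<in>id_equiv X \<epsilon>. transversal X A \<and> Inl x \<in> A \<and> Inr x \<in> A" if "x \<in> X" for x
  proof
    show "\<epsilon> `` {x} <+> \<epsilon> `` {x} \<in> id_equiv X \<epsilon>"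
      using quotientI[OF that] by (auto simp: id_equiv_def)
    show "transversal X (\<epsilon> `` {x} <+> \<epsilon> `` {x}) \<and> Inl x \<in> \<epsilon> `` {x} <+> \<epsilon> `` {x} \<and>
        Inr x \<in> \<epsilon> `` {x} <+> \<epsilon> `` {x}"
      using equiv_class_self[OF assms that] that by (auto simp: transversal_def)
  qed
  then show "part_dom X (id_equiv X \<epsilon>) = X" "part_codom X (id_equiv X \<epsilon>) = X"
    unfolding part_dom_def part_codom_def by blast+
qed

text \<open>
  If every upper vertex shares a block with a lower one, the lower half of a union of blocks decides
  for each upper vertex whether it belongs to the union. Dually the upper half decides
  the lower half.
\<close>

lemma transversal_partition_inj:
  assumes "part_dom X \<alpha> = X" "(P, Q) \<in> cut_rel X \<alpha>" "(P', Q) \<in> cut_rel X \<alpha>"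
  shows "P \<subseteq> P'"
proof
  fix x assume x: "x \<in> P"
  then have "x \<in> part_dom X \<alpha>"
    using assms(1,2) by (auto simp: cut_rel_iff)
  then obtain y where "(Inl x, Inr y) \<in> block_edges \<alpha>" "(Inr y, Inl x) \<in> block_edges \<alpha>"
    by (fastforce simp: part_dom_def transversal_def block_edges_def)
  then show "x \<in> P'"
    using assms(2,3) x unfolding cut_rel_iff by blast
qed

lemma transversal_partition_functional:
  assumes "part_codom X \<alpha> = X" "(P, Q) \<in> cut_rel X \<alpha>" "(P, Q') \<in> cut_rel X \<alpha>"
  shows "Q \<subseteq> Q'"
proof
  fix x assume x: "x \<in> Q"
  then have "x \<in> part_codom X \<alpha>"
    using assms(1,2) by (auto simp: cut_rel_iff)
  then obtain y where "(Inr x, Inl y) \<in> block_edges \<alpha>" "(Inl y, Inr x) \<in> block_edges \<alpha>"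
    by (fastforce simp: part_codom_def transversal_def block_edges_def)
  then show "x \<in> Q'"
    using assms(2,3) x unfolding cut_rel_iff by blast
qed

lemma idempotents_dual_symmetric_inverse_monoid:
  "idempotents (dual_symmetric_inverse_monoid X) = {id_equiv X \<epsilon> | \<epsilon>. equiv X \<epsilon>}"
proof (intro subset_antisym subsetI)
  fix \<alpha> assume "\<alpha> \<in> idempotents (dual_symmetric_inverse_monoid X)"
  then have \<alpha>: "partition_on (X <+> X) \<alpha>" and dom: "part_dom X \<alpha> = X" "part_codom X \<alpha> = X"
    and "partition_mult X \<alpha> \<alpha> = \<alpha>"
    by (auto simp: idempotents_def dual_symmetric_inverse_monoid_def partition_monoid_def)
  then have idem: "cut_rel X \<alpha> O cut_rel X \<alpha> = cut_rel X \<alpha>"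
    using cut_rel_mult by metis
  have "cut_rel X \<alpha> \<subseteq> Id"
  proof (rule subrelI)
    fix P Q assume PQ: "(P, Q) \<in> cut_rel X \<alpha>"
    obtain M where M: "(P, M) \<in> cut_rel X \<alpha>" "(M, Q) \<in> cut_rel X \<alpha>"
      using PQ idem by blast
    have "M = Q"
      using transversal_partition_functional[OF dom(2)] PQ M(1) by blast
    then show "(P, Q) \<in> Id"
      using transversal_partition_inj[OF dom(1)] PQ M(2) by blast
  qed
  then have "\<alpha> = id_equiv X (upper_kernel \<alpha>)"
    by (rule id_equiv_upper_kernel[OF \<alpha>])
  then show "\<alpha> \<in> {id_equiv X \<epsilon> | \<epsilon>. equiv X \<epsilon>}"
    using equiv_kernels(1)[OF \<alpha>] by blast
next
  interpret relational_representation "partition_monoid X"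
    "{id_equiv X \<epsilon> | \<epsilon>. equiv X \<epsilon>}" "cut_rel X"
    by (rule relational_representation_partition_monoid)
  interpret semigroup_with_semilattice "partition_monoid X" "{id_equiv X \<epsilon> | \<epsilon>. equiv X \<epsilon>}"
    by (rule semigroup_with_semilattice)
  fix e assume e: "e \<in> {id_equiv X \<epsilon> | \<epsilon>. equiv X \<epsilon>}"
  then have "part_dom X e = X" "part_codom X e = X"
    using id_equiv_full_domain by blast+
  moreover have "e \<in> idempotents (partition_monoid X)"
    using idem e by blast
  ultimately show "e \<in> idempotents (dual_symmetric_inverse_monoid X)"
    by (simp add: idempotents_def dual_symmetric_inverse_monoid_def)
qed

theorem theorem4p8:
  fixes X :: "'a set"
  shows "idempotents (dual_symmetric_inverse_monoid X) = {id_equiv X \<epsilon> | \<epsilon>. equiv X \<epsilon>}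
    \<and> ehresmann (partition_monoid X) (idempotents (dual_symmetric_inverse_monoid X))"
  using relational_representation.ehresmann[OF relational_representation_partition_monoid]
  by (simp add: idempotents_dual_symmetric_inverse_monoid)

end
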